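(* A set $A\subseteq\mathbb{Z}^2$ is 4-connected if and only if $\Gamma(A)$ is connected in $\mathbb{K}^2$ (with the subspace topology).
   Context: Two points of $\mathbb{Z}^2$ are 4-adjacent if they differ by $(\pm1,0)$ or $(0,\pm1)$. A subset $S\subseteq\mathbb{Z}^2$ is 4-connected if it cannot be partitioned into two nonempty subsets $P,Q$ such that no point of $P$ is 4-adjacent to a point of $Q$. $\mathbb{K}$ is $\mathbb{Z}$ with the Khalimsky topology, generated by the sets $N(n)=\{n\}$ for $n$ odd and $N(n)=\{n-1,n,n+1\}$ for $n$ even; $\mathbb{K}^2$ has the product topology. $\Gamma:\mathbb{Z}^2\to\mathbb{K}^2$ is $\Gamma(x,y)=(x+y,y-x)$. The empty set is regarded as connected in both senses. *)

theory Defs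
  imports "HOL-Analysis.Analysis"
begin

definition four_adjacent :: "int \<times> int \<Rightarrow> int \<times> int \<Rightarrow> bool" where
  "four_adjacent p q \<longleftrightarrow>
     (fst q - fst p, snd q - snd p) \<in> {(1, 0), (-1, 0), (0, 1), (0, -1)}"

definition four_connected :: "(int \<times> int) set \<Rightarrow> bool" where
  "four_connected S \<longleftrightarrow>
     \<not> (\<exists>P Q. P \<noteq> {} \<and> Q \<noteq> {} \<and> P \<union> Q = S \<and> P \<inter> Q = {} \<and>
            (\<forall>p\<in>P. \<forall>q\<in>Q. \<not> four_adjacent p q))"

definition khalimsky_nbhd :: "int \<Rightarrow> int set" where
  "khalimsky_nbhd n = (if odd n then {n} else {n - 1, n, n + 1})"

definition khalimsky_line :: "int topology" where
  "khalimsky_line = topology_generated_by (range khalimsky_nbhd)"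

lemma topspace_khalimsky_line [simp]: "topspace khalimsky_line = UNIV"
proof -
  have "n \<in> khalimsky_nbhd n" for n
    by (simp add: khalimsky_nbhd_def)
  then show ?thesis
    by (auto simp: khalimsky_line_def topology_generated_by_topspace)
qed

(* An abstract topology rather than an instance of topological_space: the type
   int already carries the discrete topology as its type-class topology. *)
definition khalimsky_plane :: "(int \<times> int) topology" where
  "khalimsky_plane = prod_topology khalimsky_line khalimsky_line"

definition Gamma_map :: "int \<times> int \<Rightarrow> int \<times> int" where
  "Gamma_map = (\<lambda>(x, y). (x + y, y - x))"

end

theory Submission
  imports Defs
begin

text \<open>
  In a Khalimsky space every point has a smallest open neighbourhood. At a point of the image of
  \<open>Gamma_map\<close> the coordinates have equal parity: the smallest neighbourhood of an
  odd-odd point is a singleton, while that of an even-even point meets the image exactly in the point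
  and the images of its four neighbours. As 4-adjacent points have coordinate sums of opposite
  parity, exactly one of their images is the even-even one, so separations of the image by open sets
  correspond to partitions without adjacencies.
\<close>

lemma khalimsky_nbhd_refl: "n \<in> khalimsky_nbhd n"
  by (simp add: khalimsky_nbhd_def)

text \<open>Only an even \<open>m\<close> has a neighbourhood with further points; these are odd, so
  their own neighbourhoods are singletons.\<close>

lemma khalimsky_nbhd_mono:
  assumes "n \<in> khalimsky_nbhd m"
  shows "khalimsky_nbhd n \<subseteq> khalimsky_nbhd m"
  using assms by (auto simp: khalimsky_nbhd_def split: if_splits)

lemma openin_khalimsky_nbhd: "openin khalimsky_line (khalimsky_nbhd n)"
  unfolding khalimsky_line_def by (rule topology_generated_by_Basis) simp

text \<open>Containing \<open>khalimsky_nbhd n\<close> for each member \<open>n\<close> is a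
  property that survives binary intersections and arbitrary unions. The generators have it by
  \<open>khalimsky_nbhd_mono\<close>, so induction over the generated topology gives it for all open
  sets.\<close>

lemma khalimsky_nbhd_least:
  assumes "openin khalimsky_line U" "n \<in> U"
  shows "khalimsky_nbhd n \<subseteq> U"
proof -
  have "generate_topology_on (range khalimsky_nbhd) U"
    using assms(1) by (simp add: khalimsky_line_def openin_topology_generated_by_iff)
  then have "\<forall>n\<in>U. khalimsky_nbhd n \<subseteq> U"
  proof induction
    case (Basis s)
    then show ?case
      using khalimsky_nbhd_mono by blast
  qed blast+
  then show ?thesis
    using assms(2) by blast
qed

definition plane_nbhd :: "int \<times> int \<Rightarrow> (int \<times> int) set" where
  "plane_nbhd p = khalimsky_nbhd (fst p) \<times> khalimsky_nbhd (snd p)"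

lemma plane_nbhd_refl: "p \<in> plane_nbhd p"
  by (cases p) (simp add: plane_nbhd_def khalimsky_nbhd_refl)

lemma openin_plane_nbhd: "openin khalimsky_plane (plane_nbhd p)"
  by (simp add: khalimsky_plane_def plane_nbhd_def openin_prod_Times_iff openin_khalimsky_nbhd)

lemma plane_nbhd_least:
  assumes "openin khalimsky_plane U" "p \<in> U"
  shows "plane_nbhd p \<subseteq> U"
proof -
  obtain V W where "openin khalimsky_line V" "openin khalimsky_line W"
    and "fst p \<in> V" "snd p \<in> W" "V \<times> W \<subseteq> U"
    using assms unfolding khalimsky_plane_def openin_prod_topology_alt
    by (metis prod.collapse)
  then show ?thesis
    unfolding plane_nbhd_def using khalimsky_nbhd_least by blast
qed

lemma Gamma_map_in_plane_nbhd_iff: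
  "Gamma_map q \<in> plane_nbhd (Gamma_map p) \<longleftrightarrow>
     q = p \<or> even (fst p + snd p) \<and> four_adjacent p q"
proof -
  obtain x y u v where pq: "p = (x, y)" "q = (u, v)"
    by fastforce
  show ?thesis
  proof (cases "even (x + y)")
    case True
    \<comment> \<open>Since \<open>y - x\<close> and \<open>x + y\<close> differ by
      \<open>2 * x\<close>, both coordinates are even.\<close>
    then have "khalimsky_nbhd (x + y) = {x + y - 1, x + y, x + y + 1}"
      "khalimsky_nbhd (y - x) = {y - x - 1, y - x, y - x + 1}"
      by (simp_all add: khalimsky_nbhd_def)
    then have "Gamma_map q \<in> plane_nbhd (Gamma_map p) \<longleftrightarrow>
        u + v \<in> {x + y - 1, x + y, x + y + 1} \<and> v - u \<in> {y - x - 1, y - x, y - x + 1}"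
      by (simp only: pq plane_nbhd_def Gamma_map_def prod.case fst_conv snd_conv mem_Times_iff)
    also have "\<dots> \<longleftrightarrow> q = p \<or> four_adjacent p q"
    proof
      assume "u + v \<in> {x + y - 1, x + y, x + y + 1} \<and> v - u \<in> {y - x - 1, y - x, y - x + 1}"
      \<comment> \<open>For the displacement (a, b) from \<open>p\<close> to \<open>q\<close> these
        bounds on a + b and b - a say that |a| + |b| \<le> 1, which leaves the origin and the four
        unit steps.\<close>
      then have bounds: "\<bar>(u - x) + (v - y)\<bar> \<le> 1" "\<bar>(v - y) - (u - x)\<bar> \<le> 1"
        by auto
      then have "u - x = -1 \<or> u - x = 0 \<or> u - x = 1" "v - y = -1 \<or> v - y = 0 \<or> v - y = 1"
        by linarith+
      then show "q = p \<or> four_adjacent p q"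
        using bounds by (auto simp: pq four_adjacent_def)
    next
      assume "q = p \<or> four_adjacent p q"
      then have "u - x = 0 \<and> v - y = 0 \<or> u - x = 1 \<and> v - y = 0 \<or> u - x = -1 \<and> v - y = 0 \<or>
          u - x = 0 \<and> v - y = 1 \<or> u - x = 0 \<and> v - y = -1"
        by (auto simp: pq four_adjacent_def)
      then show "u + v \<in> {x + y - 1, x + y, x + y + 1} \<and> v - u \<in> {y - x - 1, y - x, y - x + 1}"
        unfolding insert_iff by (elim disjE conjE; simp add: diff_eq_eq)
    qed
    finally show ?thesis
      using True by (simp add: pq)
  next
    case False
    then have "khalimsky_nbhd (x + y) = {x + y}" "khalimsky_nbhd (y - x) = {y - x}"
      by (simp_all add: khalimsky_nbhd_def)
    then have "Gamma_map q \<in> plane_nbhd (Gamma_map p) \<longleftrightarrow> u + v = x + y \<and> v - u = y - x"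
      by (simp add: pq plane_nbhd_def Gamma_map_def)
    also have "\<dots> \<longleftrightarrow> q = p"
      unfolding pq prod.inject by arith
    finally show ?thesis
      using False by (simp add: pq)
  qed
qed

lemma four_adjacent_sym: "four_adjacent p q \<Longrightarrow> four_adjacent q p"
  by (auto simp: four_adjacent_def)

lemma four_adjacent_parity:
  assumes "four_adjacent p q"
  shows "even (fst p + snd p) \<or> even (fst q + snd q)"
proof -
  have "fst q + snd q = fst p + snd p + 1 \<or> fst q + snd q = fst p + snd p - 1"
    using assms by (auto simp: four_adjacent_def)
  then show ?thesis
    by presburger
qed

theorem theorem5p1:
  fixes A :: "(int \<times> int) set"
  shows "four_connected A \<longleftrightarrow> connectedin khalimsky_plane (Gamma_map ` A)"
proof
  assume A: "four_connected A"
  show "connectedin khalimsky_plane (Gamma_map ` A)"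
    unfolding connectedin
  proof (intro conjI notI)
    show "Gamma_map ` A \<subseteq> topspace khalimsky_plane"
      by (simp add: khalimsky_plane_def)
  next
    assume "\<exists>E1 E2. openin khalimsky_plane E1 \<and> openin khalimsky_plane E2 \<and>
      Gamma_map ` A \<subseteq> E1 \<union> E2 \<and> E1 \<inter> E2 \<inter> Gamma_map ` A = {} \<and>
      E1 \<inter> Gamma_map ` A \<noteq> {} \<and> E2 \<inter> Gamma_map ` A \<noteq> {}"
    then obtain E1 E2 where E: "openin khalimsky_plane E1" "openin khalimsky_plane E2"
      "Gamma_map ` A \<subseteq> E1 \<union> E2" "E1 \<inter> E2 \<inter> Gamma_map ` A = {}"
      "E1 \<inter> Gamma_map ` A \<noteq> {}" "E2 \<inter> Gamma_map ` A \<noteq> {}"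
      by (elim exE conjE)
    define P Q where "P = {a \<in> A. Gamma_map a \<in> E1}" and "Q = {a \<in> A. Gamma_map a \<in> E2}"
    have "\<not> four_adjacent p q" if p: "p \<in> P" and q: "q \<in> Q" for p q
    proof
      assume adj: "four_adjacent p q"
      have "Gamma_map q \<in> plane_nbhd (Gamma_map p) \<or> Gamma_map p \<in> plane_nbhd (Gamma_map q)"
        using four_adjacent_parity[OF adj] adj four_adjacent_sym[OF adj]
        by (auto simp: Gamma_map_in_plane_nbhd_iff)
      \<comment> \<open>An open set containing the even-even image also contains the other image, so
        one of the two lies in both \<open>E1\<close> and \<open>E2\<close>.\<close>
      then have "Gamma_map q \<in> E1 \<or> Gamma_map p \<in> E2"
        using plane_nbhd_least[OF E(1), of "Gamma_map p"] plane_nbhd_least[OF E(2), of "Gamma_map q"] p q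
        by (auto simp: P_def Q_def)
      then show False
        using p q E(4) by (auto simp: P_def Q_def)
    qed
    moreover have "P \<noteq> {}"
      using E(5) by (auto simp: P_def)
    moreover have "Q \<noteq> {}"
      using E(6) by (auto simp: Q_def)
    moreover have "P \<union> Q = A"
      using E(3) by (auto simp: P_def Q_def)
    moreover have "P \<inter> Q = {}"
      using E(4) by (auto simp: P_def Q_def)
    ultimately show False
      using A unfolding four_connected_def by metis
  qed
next
  assume conn: "connectedin khalimsky_plane (Gamma_map ` A)"
  show "four_connected A"
    unfolding four_connected_def
  proof
    assume "\<exists>P Q. P \<noteq> {} \<and> Q \<noteq> {} \<and> P \<union> Q = A \<and> P \<inter> Q = {} \<and>
      (\<forall>p\<in>P. \<forall>q\<in>Q. \<not> four_adjacent p q)"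
    then obtain P Q where PQ: "P \<noteq> {}" "Q \<noteq> {}" "P \<union> Q = A" "P \<inter> Q = {}"
      and nadj: "\<And>p q. p \<in> P \<Longrightarrow> q \<in> Q \<Longrightarrow> \<not> four_adjacent p q"
      by metis
    \<comment> \<open>\<open>E S\<close> is the smallest open set containing the image of
      \<open>S\<close>. The sets \<open>E P\<close> and \<open>E Q\<close> may overlap, but only
      outside the image of \<open>A\<close>.\<close>
    define E where "E S = (\<Union>p\<in>S. plane_nbhd (Gamma_map p))" for S
    have opn: "openin khalimsky_plane (E S)" for S
      unfolding E_def by (rule openin_Union) (auto intro: openin_plane_nbhd)
    have sub: "Gamma_map ` S \<subseteq> E S" for S
      unfolding E_def by (blast intro: plane_nbhd_refl)
    \<comment> \<open>Otherwise \<open>r\<close> equals some \<open>q\<close> in \<open>Q\<close>,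
      against disjointness, or \<open>q\<close> is adjacent to \<open>r\<close>; symmetry is needed
      because \<open>nadj\<close> runs from \<open>P\<close> to \<open>Q\<close>.\<close>
    have "Gamma_map r \<notin> E Q" if "r \<in> P" for r
      using that PQ(4) nadj four_adjacent_sym
      unfolding E_def UN_iff Gamma_map_in_plane_nbhd_iff by blast
    moreover have "Gamma_map r \<notin> E P" if "r \<in> Q" for r
      using that PQ(4) nadj
      unfolding E_def UN_iff Gamma_map_in_plane_nbhd_iff by blast
    ultimately have "E P \<inter> E Q \<inter> Gamma_map ` A = {}"
      using PQ(3) by blast
    moreover have "Gamma_map ` A \<subseteq> E P \<union> E Q"
      using PQ(3) sub[of P] sub[of Q] by auto
    moreover have "E P \<inter> Gamma_map ` A \<noteq> {}"
      using PQ(1,3) sub[of P] by auto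
    moreover have "E Q \<inter> Gamma_map ` A \<noteq> {}"
      using PQ(2,3) sub[of Q] by auto
    ultimately show False
      using conn opn[of P] opn[of Q] unfolding connectedin by metis
  qed
qed

end
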